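(* Let $\omega=(\omega_i)_{i\geq 1}$ with $\omega_i=\frac{1}{i^2}$, and let $B_\omega:\ell_1\to\ell_1$ be defined by $[B_\omega(x)]_i=\omega_i x_{i+1}$ for $i\ge 1$. The bilinear operator $M:\ell_1\times\ell_1\to\ell_1$ given by $M(x,y)=e_1'(y)\,B_\omega(x)$ is hypercyclic.
   Context: $\ell_1$ is the complex Banach space of absolutely summable sequences $x=(x_i)_{i\geq 1}$, $[x]_i=x_i$ denotes the $i$-th coordinate, and $e_1'(y)=y_1$ is the first coordinate functional. For a continuous bilinear operator $M:X\times X\to X$ on a Banach space and initial conditions $(x_{-1},x_0)\in X^2$, define inductively $x_n:=M(x_{n-2},x_{n-1})$ for $n\geq 1$. The operator $M$ is called hypercyclic if there exists $(x_{-1},x_0)\in X^2$ such that the orbit $\{x_n:n\geq -1\}$ is dense in $X$. *)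

theory Defs
  imports "HOL-Analysis.Analysis"
begin

section \<open>Complex Banach spaces\<close>

text \<open>
  The underlying real structure is that of \<^class>\<open>real_normed_vector\<close>, so that the
  norm topology and completeness are those of the library.
\<close>

class complex_normed_vector = real_normed_vector +
  fixes scaleC :: "complex \<Rightarrow> 'a \<Rightarrow> 'a"  (infixr \<open>*\<^sub>C\<close> 75)
  assumes scaleC_add_right: "c *\<^sub>C (x + y) = c *\<^sub>C x + c *\<^sub>C y"
    and scaleC_add_left: "(c + d) *\<^sub>C x = c *\<^sub>C x + d *\<^sub>C x"
    and scaleC_scaleC: "c *\<^sub>C d *\<^sub>C x = (c * d) *\<^sub>C x"
    and scaleC_one: "1 *\<^sub>C x = x"
    and scaleR_scaleC: "r *\<^sub>R x = complex_of_real r *\<^sub>C x"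
    and norm_scaleC: "norm (c *\<^sub>C x) = cmod c * norm x"

class complex_banach = complex_normed_vector + banach

definition bounded_cbilinear ::
    "('a::complex_normed_vector \<Rightarrow> 'b::complex_normed_vector \<Rightarrow> 'c::complex_normed_vector) \<Rightarrow> bool"
  where "bounded_cbilinear M \<longleftrightarrow>
    bounded_bilinear M \<and>
    (\<forall>c x y. M (c *\<^sub>C x) y = c *\<^sub>C M x y) \<and>
    (\<forall>c x y. M x (c *\<^sub>C y) = c *\<^sub>C M x y)"


section \<open>Orbits and hypercyclicity of bilinear operators\<close>

text \<open>
  The orbit sequence is numbered from 0, so that \<open>orbit_seq M a b n\<close> is the term
  \<open>x\<^bsub>n-1\<^esub>\<close> of the sequence with initial conditions \<open>x\<^bsub>-1\<^esub> = a\<close> and \<open>x\<^bsub>0\<^esub> = b\<close>.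
\<close>

fun orbit_seq :: "('a \<Rightarrow> 'a \<Rightarrow> 'a) \<Rightarrow> 'a \<Rightarrow> 'a \<Rightarrow> nat \<Rightarrow> 'a" where
  "orbit_seq M a b 0 = a"
| "orbit_seq M a b (Suc 0) = b"
| "orbit_seq M a b (Suc (Suc n)) = M (orbit_seq M a b n) (orbit_seq M a b (Suc n))"

text \<open>
  Hypercyclicity is meant for continuous bilinear operators; that \<open>M\<close> is one is expressed
  separately by \<^const>\<open>bounded_cbilinear\<close>.
\<close>

definition hypercyclic :: "('a::complex_banach \<Rightarrow> 'a \<Rightarrow> 'a) \<Rightarrow> bool" where
  "hypercyclic M \<longleftrightarrow> (\<exists>a b. closure (range (orbit_seq M a b)) = UNIV)"


section \<open>The space of absolutely summable complex sequences\<close>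

text \<open>Sequences are indexed from 0: \<open>ell1_nth x n\<close> is the coordinate \<open>[x]\<^bsub>n+1\<^esub>\<close>.\<close>

typedef ell1 = "{x :: nat \<Rightarrow> complex. summable (\<lambda>n. cmod (x n))}"
  morphisms ell1_nth Abs_ell1
  by (rule exI[of _ "\<lambda>_. 0"]) simp

setup_lifting type_definition_ell1

lemma summable_ell1_nth: "summable (\<lambda>n. cmod (ell1_nth x n))"
  using ell1_nth by simp

lemma ell1_eqI: "(\<And>n. ell1_nth x n = ell1_nth y n) \<Longrightarrow> x = y"
  by (simp add: ell1_nth_inject[symmetric] fun_eq_iff)

lemma summable_cmod_add:
  assumes "summable (\<lambda>n. cmod (f n))" "summable (\<lambda>n. cmod (g n))"
  shows "summable (\<lambda>n. cmod (f n + g n))"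
  by (rule summable_comparison_test'[OF summable_add[OF assms], of 0])
     (simp add: norm_triangle_ineq)

instantiation ell1 :: complex_normed_vector
begin

lift_definition zero_ell1 :: ell1 is "\<lambda>_. 0" by simp

lift_definition plus_ell1 :: "ell1 \<Rightarrow> ell1 \<Rightarrow> ell1" is "\<lambda>x y n. x n + y n"
  by (rule summable_cmod_add)

lift_definition uminus_ell1 :: "ell1 \<Rightarrow> ell1" is "\<lambda>x n. - x n" by simp

lift_definition minus_ell1 :: "ell1 \<Rightarrow> ell1 \<Rightarrow> ell1" is "\<lambda>x y n. x n - y n"
  subgoal for f g using summable_cmod_add[of f "\<lambda>n. - g n"] by simp
  done

lift_definition scaleC_ell1 :: "complex \<Rightarrow> ell1 \<Rightarrow> ell1" is "\<lambda>c x n. c * x n"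
  by (simp add: norm_mult summable_mult)

definition scaleR_ell1 :: "real \<Rightarrow> ell1 \<Rightarrow> ell1" where
  "scaleR_ell1 r x = complex_of_real r *\<^sub>C x"

definition norm_ell1 :: "ell1 \<Rightarrow> real" where
  "norm_ell1 x = (\<Sum>n. cmod (ell1_nth x n))"

definition sgn_ell1 :: "ell1 \<Rightarrow> ell1" where
  "sgn_ell1 x = inverse (norm x) *\<^sub>R x"

definition dist_ell1 :: "ell1 \<Rightarrow> ell1 \<Rightarrow> real" where
  "dist_ell1 x y = norm (x - y)"

definition uniformity_ell1 :: "(ell1 \<times> ell1) filter" where
  "uniformity_ell1 = (INF e\<in>{0<..}. principal {(x, y). dist x y < e})"

definition open_ell1 :: "ell1 set \<Rightarrow> bool" where
  "open_ell1 U \<longleftrightarrow> (\<forall>x\<in>U. eventually (\<lambda>(x', y). x' = x \<longrightarrow> y \<in> U) uniformity)"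

instance
proof
  fix x y z :: ell1 and r s :: real and c d :: complex and U :: "ell1 set"
  show "x + y + z = x + (y + z)" by transfer (simp add: add.assoc)
  show "x + y = y + x" by transfer (simp add: add.commute)
  show "0 + x = x" by transfer simp
  show "- x + x = 0" by transfer simp
  show "x - y = x + - y" by transfer simp
  show C1: "c *\<^sub>C (x + y) = c *\<^sub>C x + c *\<^sub>C y" for c and x y :: ell1
    by transfer (simp add: algebra_simps)
  show C2: "(c + d) *\<^sub>C x = c *\<^sub>C x + d *\<^sub>C x" for c d and x :: ell1
    by transfer (simp add: algebra_simps)
  show C3: "c *\<^sub>C d *\<^sub>C x = (c * d) *\<^sub>C x" for c d and x :: ell1
    by transfer (simp add: algebra_simps)
  show C4: "1 *\<^sub>C x = x" by transfer simp
  show "r *\<^sub>R x = complex_of_real r *\<^sub>C x" by (rule scaleR_ell1_def)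
  show "r *\<^sub>R (x + y) = r *\<^sub>R x + r *\<^sub>R y" by (simp add: scaleR_ell1_def C1)
  show "(r + s) *\<^sub>R x = r *\<^sub>R x + s *\<^sub>R x" by (simp add: scaleR_ell1_def C2)
  show "r *\<^sub>R s *\<^sub>R x = (r * s) *\<^sub>R x" by (simp add: scaleR_ell1_def C3)
  show "1 *\<^sub>R x = x" by (simp add: scaleR_ell1_def C4)
  show "dist x y = norm (x - y)" by (rule dist_ell1_def)
  show "sgn x = inverse (norm x) *\<^sub>R x" by (rule sgn_ell1_def)
  show "uniformity = (INF e\<in>{0<..}. principal {(x :: ell1, y). dist x y < e})"
    by (rule uniformity_ell1_def)
  show "open U = (\<forall>x\<in>U. \<forall>\<^sub>F (x', y) in uniformity. x' = x \<longrightarrow> y \<in> U)"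
    by (rule open_ell1_def)
  show nC: "norm (c *\<^sub>C x) = cmod c * norm x" for c and x :: ell1
    unfolding norm_ell1_def
    by (simp add: scaleC_ell1.rep_eq norm_mult suminf_mult summable_ell1_nth)
  show "norm (r *\<^sub>R x) = \<bar>r\<bar> * norm x" by (simp add: scaleR_ell1_def nC)
  have "norm x = 0 \<longleftrightarrow> (\<forall>n. ell1_nth x n = 0)"
    unfolding norm_ell1_def by (simp add: suminf_eq_zero_iff summable_ell1_nth)
  also have "\<dots> \<longleftrightarrow> x = 0" by transfer auto
  finally show "norm x = 0 \<longleftrightarrow> x = 0" .
  have "norm (x + y) \<le> (\<Sum>n. cmod (ell1_nth x n) + cmod (ell1_nth y n))"
    unfolding norm_ell1_def
    by (rule suminf_le)
       (auto simp: plus_ell1.rep_eq norm_triangle_ineq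
             intro!: summable_cmod_add summable_add summable_ell1_nth)
  also have "\<dots> = norm x + norm y"
    unfolding norm_ell1_def by (rule suminf_add[symmetric]) (rule summable_ell1_nth)+
  finally show "norm (x + y) \<le> norm x + norm y" .
qed

end

lemma sum_cmod_le_norm_ell1: "(\<Sum>n<k. cmod (ell1_nth x n)) \<le> norm x"
  unfolding norm_ell1_def by (rule sum_le_suminf) (auto simp: summable_ell1_nth)

lemma cmod_nth_le_norm_ell1: "cmod (ell1_nth x n) \<le> norm x"
proof -
  have "cmod (ell1_nth x n) \<le> (\<Sum>i<Suc n. cmod (ell1_nth x i))"
    by (simp add: sum_nonneg)
  then show ?thesis using sum_cmod_le_norm_ell1 by (rule order_trans)
qed

instance ell1 :: complex_banach
proof
  fix X :: "nat \<Rightarrow> ell1"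
  assume X: "Cauchy X"
  have "Cauchy (\<lambda>m. ell1_nth (X m) n)" for n
  proof (rule metric_CauchyI)
    fix e :: real assume "e > 0"
    then obtain N where N: "\<And>m k. m \<ge> N \<Longrightarrow> k \<ge> N \<Longrightarrow> dist (X m) (X k) < e"
      using metric_CauchyD[OF X] by blast
    have "dist (ell1_nth (X m) n) (ell1_nth (X k) n) < e" if "m \<ge> N" "k \<ge> N" for m k
      using N[OF that] cmod_nth_le_norm_ell1[of "X m - X k" n]
      by (simp add: dist_norm minus_ell1.rep_eq)
    then show "\<exists>N. \<forall>m\<ge>N. \<forall>k\<ge>N. dist (ell1_nth (X m) n) (ell1_nth (X k) n) < e"
      by blast
  qed
  then have "\<forall>n. \<exists>l. (\<lambda>m. ell1_nth (X m) n) \<longlonglongrightarrow> l"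
    by (simp add: Cauchy_convergent_iff convergent_def)
  from choice[OF this] obtain L where L: "(\<lambda>m. ell1_nth (X m) n) \<longlonglongrightarrow> L n" for n
    by blast
  have tail: "\<exists>N. \<forall>m\<ge>N. \<forall>K. (\<Sum>n<K. cmod (ell1_nth (X m) n - L n)) \<le> e" if "e > 0" for e
  proof -
    obtain N where N: "\<And>m k. m \<ge> N \<Longrightarrow> k \<ge> N \<Longrightarrow> dist (X m) (X k) < e"
      using metric_CauchyD[OF X \<open>e > 0\<close>] by blast
    have "(\<Sum>n<K. cmod (ell1_nth (X m) n - L n)) \<le> e" if m: "m \<ge> N" for m K
    proof (rule LIMSEQ_le_const2)
      show "(\<lambda>k. \<Sum>n<K. cmod (ell1_nth (X m) n - ell1_nth (X k) n))
              \<longlonglongrightarrow> (\<Sum>n<K. cmod (ell1_nth (X m) n - L n))"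
        by (intro tendsto_intros L)
      have "(\<Sum>n<K. cmod (ell1_nth (X m) n - ell1_nth (X k) n)) \<le> e" if "k \<ge> N" for k
        using N[OF m that] sum_cmod_le_norm_ell1[of "X m - X k" K]
        by (simp add: dist_norm minus_ell1.rep_eq)
      then show "\<exists>N. \<forall>k\<ge>N. (\<Sum>n<K. cmod (ell1_nth (X m) n - ell1_nth (X k) n)) \<le> e"
        by blast
    qed
    then show ?thesis by blast
  qed
  have summ: "summable (\<lambda>n. cmod (ell1_nth (X m) n - L n))"
    if "\<forall>K. (\<Sum>n<K. cmod (ell1_nth (X m) n - L n)) \<le> e" for m e
    by (rule summableI_nonneg_bounded[where x = e]) (use that in auto)
  obtain m where "\<forall>K. (\<Sum>n<K. cmod (ell1_nth (X m) n - L n)) \<le> 1"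
    using tail[of 1] by auto
  then have "summable (\<lambda>n. cmod (L n))"
    using summable_cmod_add[OF summable_ell1_nth[of "X m"],
        of "\<lambda>n. - (ell1_nth (X m) n - L n)"] summ[of m 1]
    by (simp add: norm_minus_commute)
  then have nthL: "ell1_nth (Abs_ell1 L) = L" by (simp add: Abs_ell1_inverse)
  have "X \<longlonglongrightarrow> Abs_ell1 L"
  proof (rule metric_LIMSEQ_I)
    fix e :: real assume "e > 0"
    then obtain N where N: "\<forall>m\<ge>N. \<forall>K. (\<Sum>n<K. cmod (ell1_nth (X m) n - L n)) \<le> e / 2"
      using tail[of "e / 2"] by auto
    have "dist (X m) (Abs_ell1 L) < e" if "m \<ge> N" for m
    proof -
      have *: "\<forall>K. (\<Sum>n<K. cmod (ell1_nth (X m) n - L n)) \<le> e / 2" using N that by blast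
      have "dist (X m) (Abs_ell1 L) = (\<Sum>n. cmod (ell1_nth (X m) n - L n))"
        by (simp add: dist_norm norm_ell1_def minus_ell1.rep_eq nthL)
      also have "\<dots> \<le> e / 2" by (rule suminf_le_const[OF summ[OF *]]) (use * in blast)
      finally show ?thesis using \<open>e > 0\<close> by simp
    qed
    then show "\<exists>N. \<forall>m\<ge>N. dist (X m) (Abs_ell1 L) < e" by blast
  qed
  then show "convergent X" by (rule convergentI)
qed


section \<open>The weighted backward shift and the bilinear operator\<close>

definition first_coord :: "ell1 \<Rightarrow> complex" where
  "first_coord y = ell1_nth y 0"

text \<open>The weights, with their index \<open>i \<ge> 1\<close>.\<close>

definition \<omega> :: "nat \<Rightarrow> complex" where
  "\<omega> i = 1 / of_nat i ^ 2"

lemma cmod_weight_le_1: "cmod (\<omega> i) \<le> 1"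
  by (cases "i = 0") (simp_all add: \<omega>_def norm_divide norm_power)

text \<open>
  Entry \<open>n\<close> is the coordinate \<open>i = n + 1\<close>, whence the weight \<open>\<omega> (Suc n)\<close>.
\<close>

lift_definition B_\<omega> :: "ell1 \<Rightarrow> ell1" is "\<lambda>x n. \<omega> (Suc n) * x (Suc n)"
proof -
  fix x :: "nat \<Rightarrow> complex"
  assume "summable (\<lambda>n. cmod (x n))"
  then have "summable (\<lambda>n. cmod (x (Suc n)))" by (subst summable_Suc_iff)
  then show "summable (\<lambda>n. cmod (\<omega> (Suc n) * x (Suc n)))"
    by (rule summable_comparison_test'[where N = 0])
       (simp add: norm_mult mult_left_le_one_le cmod_weight_le_1)
qed

definition M_\<omega> :: "ell1 \<Rightarrow> ell1 \<Rightarrow> ell1" where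
  "M_\<omega> x y = first_coord y *\<^sub>C B_\<omega> x"

end

theory Submission
  imports Defs "HOL-Library.Discrete_Functions" "HOL-Real_Asymp.Real_Asymp"
begin

text \<open>
  Every orbit has the form \<open>x\<^bsub>2k-1\<^esub> = \<alpha>\<^sub>k B\<^sup>k a\<close>, \<open>x\<^bsub>2k\<^esub> = \<beta>\<^sub>k B\<^sup>k b\<close>, with scalars governed by
  \<open>\<alpha>\<^bsub>k+1\<^esub> = \<alpha>\<^sub>k \<beta>\<^sub>k [B\<^sup>k b]\<^sub>1\<close> and \<open>\<beta>\<^bsub>k+1\<^esub> = \<beta>\<^sub>k \<alpha>\<^bsub>k+1\<^esub> [B\<^bsup>k+1\<^esup> a]\<^sub>1\<close>. Instead of choosing \<open>b\<close>, prescribe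
  \<open>\<alpha>\<^sub>k = 2^(k^4)\<close>, which grows faster than the inverse weights of \<open>B\<^sup>k\<close>. Then \<open>a\<close> can be written
  down explicitly, placing on the block of indices \<open>n\<^sup>2, \<dots>, n\<^sup>2 + 2n\<close> exactly the entries that make
  \<open>\<alpha>\<^sub>k B\<^sup>k a\<close> with \<open>k = n\<^sup>2\<close> start with the \<open>n\<close>-th target vector; the later blocks contribute little,
  as they are divided by much larger scalars. The first recursion now determines \<open>b\<close>, and it remains
  to check that \<open>b\<close> is summable. This holds because \<open>\<beta>\<close> gains a factor of at least about
  \<open>\<alpha>\<^bsub>k+1\<^esub> / \<alpha>\<^sub>k\<close> at each step not entering a new block, so it outgrows these ratios, provided that the
  target entries are not too small. Targets are therefore taken from a sequence that comes
  arbitrarily close to each vector infinitely often, with entries of size outside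
  \<open>[1/(n+1)\<^sup>2, n+1]\<close> replaced.
\<close>

section \<open>The shift and its orbits\<close>

lemma norm_ell1_split:
  "norm x = (\<Sum>j<N. cmod (ell1_nth x j)) + (\<Sum>j. cmod (ell1_nth x (j + N)))"
  unfolding norm_ell1_def
  using suminf_split_initial_segment[OF summable_ell1_nth, of x N] by simp

lemma ell1_tail_tendsto_0: "(\<lambda>N. \<Sum>j. cmod (ell1_nth x (j + N))) \<longlonglongrightarrow> 0"
proof -
  have "(\<lambda>N. norm x - (\<Sum>j<N. cmod (ell1_nth x j))) \<longlonglongrightarrow> norm x - norm x"
    unfolding norm_ell1_def by (intro tendsto_intros summable_LIMSEQ summable_ell1_nth)
  moreover have "norm x - (\<Sum>j<N. cmod (ell1_nth x j)) = (\<Sum>j. cmod (ell1_nth x (j + N)))" for N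
    using norm_ell1_split[of x N] by simp
  ultimately show ?thesis by simp
qed

lemma norm_B_\<omega>_le: "norm (B_\<omega> x) \<le> norm x"
proof -
  have "norm (B_\<omega> x) \<le> (\<Sum>j. cmod (ell1_nth x (j + 1)))"
    unfolding norm_ell1_def
  proof (rule suminf_le[OF _ summable_ell1_nth])
    show "cmod (ell1_nth (B_\<omega> x) n) \<le> cmod (ell1_nth x (n + 1))" for n
      by (simp add: B_\<omega>.rep_eq norm_mult mult_left_le_one_le cmod_weight_le_1)
    show "summable (\<lambda>j. cmod (ell1_nth x (j + 1)))"
      using summable_ell1_nth[of x] by (subst summable_iff_shift)
  qed
  also have "\<dots> \<le> norm x"
    using norm_ell1_split[of x 1] by simp
  finally show ?thesis .
qed

lemma B_\<omega>_add: "B_\<omega> (x + y) = B_\<omega> x + B_\<omega> y"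
  by (rule ell1_eqI) (simp add: B_\<omega>.rep_eq plus_ell1.rep_eq algebra_simps)

lemma B_\<omega>_scaleC: "B_\<omega> (c *\<^sub>C x) = c *\<^sub>C B_\<omega> x"
  by (rule ell1_eqI) (simp add: B_\<omega>.rep_eq scaleC_ell1.rep_eq)

lemma bounded_cbilinear_M_\<omega>: "bounded_cbilinear M_\<omega>"
proof -
  have C1: "M_\<omega> (c *\<^sub>C x) y = c *\<^sub>C M_\<omega> x y" for c x y
    by (rule ell1_eqI) (simp add: M_\<omega>_def B_\<omega>_scaleC scaleC_ell1.rep_eq)
  have C2: "M_\<omega> x (c *\<^sub>C y) = c *\<^sub>C M_\<omega> x y" for c x y
    by (rule ell1_eqI) (simp add: M_\<omega>_def first_coord_def scaleC_ell1.rep_eq)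
  have "bounded_bilinear M_\<omega>"
  proof
    fix x x' y y' :: ell1 and r :: real
    show "M_\<omega> (x + x') y = M_\<omega> x y + M_\<omega> x' y"
      by (simp add: M_\<omega>_def B_\<omega>_add scaleC_add_right)
    show "M_\<omega> x (y + y') = M_\<omega> x y + M_\<omega> x y'"
      by (simp add: M_\<omega>_def first_coord_def plus_ell1.rep_eq scaleC_add_left)
    show "M_\<omega> (r *\<^sub>R x) y = r *\<^sub>R M_\<omega> x y" "M_\<omega> x (r *\<^sub>R y) = r *\<^sub>R M_\<omega> x y"
      by (simp_all add: scaleR_scaleC C1 C2)
    have "norm (M_\<omega> x y) \<le> norm x * norm y * 1" for x y
    proof -
      have "norm (M_\<omega> x y) = cmod (ell1_nth y 0) * norm (B_\<omega> x)"
        by (simp add: M_\<omega>_def first_coord_def norm_scaleC)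
      also have "\<dots> \<le> norm y * norm x"
        by (intro mult_mono cmod_nth_le_norm_ell1 norm_B_\<omega>_le) auto
      finally show ?thesis by (simp add: mult.commute)
    qed
    then show "\<exists>K. \<forall>x y. norm (M_\<omega> x y) \<le> norm x * norm y * K" by blast
  qed
  then show ?thesis by (simp add: bounded_cbilinear_def C1 C2)
qed

text \<open>The weights at j+1, ..., j+k multiply to a squared ratio of factorials.\<close>

lemma nth_funpow_B_\<omega>:
  "ell1_nth ((B_\<omega> ^^ k) x) j = (fact j / fact (j + k))\<^sup>2 * ell1_nth x (j + k)"
proof (induction k arbitrary: j)
  case (Suc k)
  have "fact (Suc j + k) = (fact (j + Suc k) :: complex)" by simp
  moreover have "fact (Suc j) = of_nat (Suc j) * (fact j :: complex)" by (rule fact_Suc)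
  ultimately show ?case
    by (simp del: fact_Suc of_nat_Suc
        add: B_\<omega>.rep_eq Suc \<omega>_def power_mult_distrib power_divide)
qed simp

text \<open>By \<open>nth_funpow_B_\<omega>\<close>, \<open>ell1_nth b k / fact k ^ 2\<close> is the
  first coordinate of the k-th shift of \<open>b\<close>, and likewise for \<open>a\<close>; the
  recursions are thus those imposed by \<open>M_\<omega>\<close>.\<close>

lemma orbit_M_\<omega>:
  fixes \<alpha> \<beta> :: "nat \<Rightarrow> complex"
  assumes "\<alpha> 0 = 1" "\<beta> 0 = 1"
    and \<alpha>: "\<And>k. \<alpha> (Suc k) = \<alpha> k * \<beta> k * ell1_nth b k / fact k ^ 2"
    and \<beta>: "\<And>k. \<beta> (Suc k) = \<beta> k * \<alpha> (Suc k) * ell1_nth a (Suc k) / fact (Suc k) ^ 2"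
  shows "orbit_seq M_\<omega> a b (2 * k) = \<alpha> k *\<^sub>C (B_\<omega> ^^ k) a \<and>
    orbit_seq M_\<omega> a b (Suc (2 * k)) = \<beta> k *\<^sub>C (B_\<omega> ^^ k) b"
proof (induction k)
  case 0
  then show ?case using assms(1,2) by (simp add: scaleC_one)
next
  case (Suc k)
  have 1: "orbit_seq M_\<omega> a b (Suc (Suc (2 * k))) = \<alpha> (Suc k) *\<^sub>C (B_\<omega> ^^ Suc k) a"
    unfolding orbit_seq.simps(3) conjunct1[OF Suc] conjunct2[OF Suc]
    by (simp add: M_\<omega>_def first_coord_def scaleC_ell1.rep_eq nth_funpow_B_\<omega>
        B_\<omega>_scaleC scaleC_scaleC \<alpha> power_divide mult_ac)
  have "orbit_seq M_\<omega> a b (Suc (Suc (Suc (2 * k)))) = \<beta> (Suc k) *\<^sub>C (B_\<omega> ^^ Suc k) b"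
    unfolding orbit_seq.simps(3)[of _ _ _ "Suc (2 * k)"] 1 conjunct2[OF Suc]
    by (simp add: M_\<omega>_def first_coord_def scaleC_ell1.rep_eq nth_funpow_B_\<omega>
        B_\<omega>_scaleC scaleC_scaleC \<beta> power_divide mult_ac del: fact_Suc funpow.simps)
       (simp add: mult_ac)
  with 1 show ?case by simp
qed

section \<open>A sequence visiting every neighbourhood infinitely often\<close>

text \<open>Finitely supported sequences with entries in a countable dense set are dense.
  Enumerating them by the first component of a decoded pair repeats each one infinitely
  often.\<close>

lemma ex_recurrent_dense_seq_ell1:
  "\<exists>d :: nat \<Rightarrow> ell1. \<forall>x. \<forall>e>0. \<forall>m. \<exists>n\<ge>m. norm (d n - x) < e"
proof -
  obtain D :: "complex set" where D: "countable D"
    "\<And>X. open X \<Longrightarrow> X \<noteq> {} \<Longrightarrow> \<exists>d\<in>D. d \<in> X"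
    using countable_dense_setE by blast
  define ext :: "complex list \<Rightarrow> ell1"
    where "ext l = Abs_ell1 (\<lambda>j. if j < length l then l ! j else 0)" for l
  have nth_ext: "ell1_nth (ext l) j = (if j < length l then l ! j else 0)" for l j
  proof -
    have "summable (\<lambda>j. cmod (if j < length l then l ! j else 0))"
      by (rule summable_finite[of "{..<length l}"]) auto
    then show ?thesis by (simp add: ext_def Abs_ell1_inverse)
  qed
  define d where "d n = from_nat_into (ext ` lists D) (fst (prod_decode n))" for n
  have "\<exists>n\<ge>m. norm (d n - x) < e" if e: "e > 0" for x e m
  proof -
    obtain N where N: "(\<Sum>j. cmod (ell1_nth x (j + N))) < e / 2"
      using order_tendstoD(2)[OF ell1_tail_tendsto_0, of "e / 2" x] e
      by (auto simp: eventually_sequentially)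
    \<comment> \<open>With this radius N entries contribute at most e / 2; the summand 1 covers N =
      0.\<close>
    define r where "r = e / (2 * (N + 1))"
    have "r > 0" using e by (simp add: r_def)
    have "\<exists>q\<in>D. q \<in> ball (ell1_nth x j) r" for j
      by (rule D(2)) (use \<open>r > 0\<close> in auto)
    then obtain q where q: "\<And>j. q j \<in> D" "\<And>j. dist (ell1_nth x j) (q j) < r"
      by (metis mem_ball)
    define l where "l = map q [0..<N]"
    have l: "l \<in> lists D" using q by (auto simp: l_def)
    have "norm (ext l - x) = (\<Sum>j<N. cmod (q j - ell1_nth x j)) + (\<Sum>j. cmod (ell1_nth x (j + N)))"
      by (subst norm_ell1_split[of _ N]) (simp add: minus_ell1.rep_eq nth_ext l_def)
    also have "(\<Sum>j<N. cmod (q j - ell1_nth x j)) \<le> N * r"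
      using sum_bounded_above[of "{..<N}" "\<lambda>j. cmod (q j - ell1_nth x j)" r] q(2)
      by (simp add: dist_norm norm_minus_commute less_imp_le)
    also have "N * r \<le> e / 2" using e by (simp add: r_def field_simps)
    finally have *: "norm (ext l - x) < e" using N by simp
    \<comment> \<open>The second component does not affect \<open>d n\<close>; taking it to be m
      forces n \<ge> m.\<close>
    define n where "n = prod_encode (to_nat_on (ext ` lists D) (ext l), m)"
    have "m \<le> n" by (simp add: n_def le_prod_encode_2)
    moreover have "d n = ext l"
      using l D(1) by (simp add: d_def n_def from_nat_into_to_nat_on countable_lists)
    ultimately show ?thesis using * by auto
  qed
  then show ?thesis by blast
qed

section \<open>Initial conditions adapted to a sequence of targets\<close>

lemma fact_le_two_power_square: "fact n \<le> (2 :: real) ^ n\<^sup>2"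
proof -
  have "(fact n :: real) \<le> of_nat (n ^ n)" by (metis fact_le_power order_refl of_nat_fact of_nat_le_iff)
  also have "n ^ n \<le> (2 ^ n) ^ n" by (rule power_mono) (simp_all add: less_imp_le)
  finally show ?thesis by (simp add: power_mult[symmetric] power2_eq_square)
qed

text \<open>The prescribed scalars \<alpha>. With exponent k^4, consecutive ratios are at least
  2^(4k^3), which beats squared factorials, bounded by 2^(2k^2).\<close>

definition growth :: "nat \<Rightarrow> real" where
  "growth k = 2 ^ k ^ 4"

lemma growth_pos [simp]: "growth k > 0"
  by (simp add: growth_def)

lemma growth_ge_1: "1 \<le> growth k"
  by (simp add: growth_def)

lemma growth_square: "growth (k\<^sup>2) = 2 ^ k ^ 8"
  by (simp add: growth_def flip: power_mult)

text \<open>The lower bound keeps \<beta> from shrinking too much; the upper bound serves the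
  summability of \<open>a\<close>.\<close>

locale targets =
  fixes z :: "nat \<Rightarrow> nat \<Rightarrow> complex"
  assumes target_ge: "1 / (real n + 1)\<^sup>2 \<le> cmod (z n j)"
    and target_le: "cmod (z n j) \<le> real n + 1"
begin

definition block :: "nat \<Rightarrow> nat" where
  "block i = floor_sqrt i"

definition offset :: "nat \<Rightarrow> nat" where
  "offset i = i - (block i)\<^sup>2"

text \<open>At index n^2 + j the factors undo both the weights of the n^2-fold shift and the scalar
  \<open>growth (n\<^sup>2)\<close>, leaving \<open>z n j\<close> at coordinate j.\<close>

definition a :: "nat \<Rightarrow> complex" where
  "a i = z (block i) (offset i) * (fact i / fact (offset i))\<^sup>2 / growth ((block i)\<^sup>2)"

primrec \<beta> :: "nat \<Rightarrow> complex" where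
  "\<beta> 0 = 1"
| "\<beta> (Suc k) = \<beta> k * growth (Suc k) * a (Suc k) / (fact (Suc k))\<^sup>2"

text \<open>The recursion for \<alpha> in \<open>orbit_M_\<omega>\<close>, with \<alpha> =
  \<open>growth\<close>, solved for the entry of the second initial vector.\<close>

definition b :: "nat \<Rightarrow> complex" where
  "b k = (fact k)\<^sup>2 * growth (Suc k) / (growth k * \<beta> k)"

lemma block_offset: "i = (block i)\<^sup>2 + offset i"
  by (simp add: block_def offset_def)

lemma offset_le: "offset i \<le> 2 * block i"
  using Suc_floor_sqrt_power2_gt[of i] by (simp add: block_def offset_def power2_eq_square)

lemma block_offset_eq:
  assumes "j \<le> 2 * n"
  shows "block (n\<^sup>2 + j) = n" "offset (n\<^sup>2 + j) = j"
proof -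
  show "block (n\<^sup>2 + j) = n"
    unfolding block_def using assms by (intro floor_sqrt_unique) (auto simp: power2_eq_square)
  then show "offset (n\<^sup>2 + j) = j" by (simp add: offset_def)
qed

lemma target_nonzero: "z n j \<noteq> 0"
proof
  assume "z n j = 0"
  then show False using target_ge[of n j] by (simp add: divide_le_0_iff)
qed

lemma a_nonzero: "a i \<noteq> 0"
  by (simp add: a_def target_nonzero growth_def)

lemma \<beta>_nonzero: "\<beta> k \<noteq> 0"
  by (induction k) (simp_all add: a_nonzero growth_def del: fact_Suc)

section \<open>Decay and summability of \<open>a\<close>\<close>

text \<open>An index in a later block m > n carries the divisor 2^(m^8), which absorbs 2^(n^8) and
  the factorials. The case n = 3 gives summability; general n controls the later blocks at time
  n^2.\<close>

lemma cmod_a_le: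
  assumes n: "n \<ge> 3" and i: "(n + 1)\<^sup>2 \<le> i"
  shows "growth (n\<^sup>2) * cmod (a i) \<le> (1 / 2) ^ i"
proof -
  define m where "m = block i"
  have m: "n + 1 \<le> m" using i by (simp add: m_def block_def le_floor_sqrt_iff)
  have im: "i \<le> (m + 1)\<^sup>2" using Suc_floor_sqrt_power2_gt[of i] by (simp add: m_def block_def)
  have "cmod (a i) = cmod (z m (offset i)) * (fact i / fact (offset i))\<^sup>2 / growth (m\<^sup>2)"
    by (simp add: a_def m_def norm_mult norm_divide norm_power less_imp_le)
  also have "\<dots> \<le> 2 ^ m * (2 ^ i\<^sup>2)\<^sup>2 / growth (m\<^sup>2)"
  proof (intro divide_right_mono mult_mono power_mono)
    have "m + 1 \<le> 2 ^ m" by (induction m) auto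
    then have "real (m + 1) \<le> real (2 ^ m)" by (rule of_nat_mono)
    then show "cmod (z m (offset i)) \<le> 2 ^ m" using target_le[of m "offset i"] by simp
    have "fact i / fact (offset i) \<le> (fact i :: real)"
      by (simp add: divide_le_eq fact_ge_1)
    also have "\<dots> \<le> 2 ^ i\<^sup>2" by (rule fact_le_two_power_square)
    finally show "fact i / fact (offset i) \<le> (2 ^ i\<^sup>2 :: real)" .
  qed (simp_all add: less_imp_le)
  finally have "growth (n\<^sup>2) * cmod (a i) \<le> growth (n\<^sup>2) * (2 ^ m * (2 ^ i\<^sup>2)\<^sup>2 / growth (m\<^sup>2))"
    by (rule mult_left_mono) (simp add: less_imp_le)
  also have "\<dots> = 2 ^ (n ^ 8 + m + i\<^sup>2 * 2) / 2 ^ m ^ 8"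
    by (simp add: growth_square power_add power_mult)
  also have "\<dots> \<le> (1 / 2) ^ i"
  proof -
    \<comment> \<open>As m \<ge> n + 1 and m \<ge> 4, the gap m^8 - n^8 is at least m^7 \<ge> 64
      m^4, while the other terms add up to at most 37 m^4.\<close>
    have "n ^ 8 + m + i\<^sup>2 * 2 + i \<le> m ^ 8"
    proof -
      have "n * n ^ 7 \<le> n * m ^ 7" using m by (intro mult_left_mono power_mono) auto
      moreover have "(n + 1) * m ^ 7 \<le> m * m ^ 7" using m by (rule mult_right_mono) simp
      moreover have "n ^ 8 = n * n ^ 7" "m ^ 8 = m * m ^ 7" by (simp_all flip: power_Suc)
      ultimately have 8: "n ^ 8 + m ^ 7 \<le> m ^ 8" by (simp only: distrib_right)
      have "64 * m ^ 4 \<le> m ^ 3 * m ^ 4"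
        using power_mono[of 4 m 3] m n by (intro mult_right_mono) auto
      then have 7: "64 * m ^ 4 \<le> m ^ 7" by (simp flip: power_add)
      have "(m + 1)\<^sup>2 \<le> (2 * m)\<^sup>2" using m by (intro power_mono) auto
      then have i2: "i \<le> 4 * m ^ 2" using im by (simp add: power_mult_distrib)
      have "i\<^sup>2 \<le> (4 * m ^ 2)\<^sup>2" using i2 by (rule power_mono) simp
      then have i4: "i\<^sup>2 \<le> 16 * m ^ 4" by (simp add: power_mult_distrib flip: power_mult)
      have "m ^ 1 \<le> m ^ 4" "m ^ 2 \<le> m ^ 4" using m by (intro power_increasing; simp)+
      with i2 i4 7 8 show ?thesis by simp
    qed
    then have "(2 :: real) ^ (n ^ 8 + m + i\<^sup>2 * 2 + i) \<le> 2 ^ m ^ 8" by (intro power_increasing) auto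
    then show ?thesis by (simp add: field_simps power_add)
  qed
  finally show ?thesis .
qed

lemma summable_a: "summable (\<lambda>i. cmod (a i))"
proof (rule summable_comparison_test')
  show "summable (\<lambda>i. (1 / 2 :: real) ^ i)" by (rule summable_geometric) simp
  \<comment> \<open>The threshold 16 is (3 + 1)^2, the first index covered by
    \<open>cmod_a_le\<close> for n = 3.\<close>
  show "norm (cmod (a i)) \<le> (1 / 2) ^ i" if "i \<ge> 16" for i
  proof -
    have "1 * cmod (a i) \<le> growth (3\<^sup>2) * cmod (a i)"
      by (intro mult_right_mono growth_ge_1) simp
    also have "\<dots> \<le> (1 / 2) ^ i" by (rule cmod_a_le) (use that in auto)
    finally show ?thesis by simp
  qed
qed

section \<open>Growth of \<beta> and summability of \<open>b\<close>\<close>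

lemma cmod_\<beta>_Suc:
  "cmod (\<beta> (Suc k)) = cmod (\<beta> k) * (growth (Suc k) / growth ((block (Suc k))\<^sup>2)
    * (cmod (z (block (Suc k)) (offset (Suc k))) / (fact (offset (Suc k)))\<^sup>2))"
  by (simp add: a_def norm_mult norm_divide norm_power less_imp_le field_simps del: fact_Suc)

text \<open>On entering a block the growth ratio is 1 and the factorial is 0! = 1, so only the
  target entry remains as a factor.\<close>

lemma cmod_\<beta>_Suc_ge_square:
  assumes "offset (Suc k) = 0"
  shows "cmod (\<beta> k) / 2 ^ (2 * (k + 2)) \<le> cmod (\<beta> (Suc k))"
proof -
  have sq: "(block (Suc k))\<^sup>2 = Suc k" using block_offset[of "Suc k"] assms by simp
  have "block (Suc k) + 1 \<le> k + 2" by (simp add: block_def floor_sqrt_le)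
  also have "k + 2 \<le> 2 ^ (k + 2)" by (rule less_imp_le) (rule less_exp)
  finally have "real (block (Suc k) + 1) \<le> 2 ^ (k + 2)"
    by (metis of_nat_le_iff of_nat_numeral of_nat_power)
  then have "(real (block (Suc k) + 1))\<^sup>2 \<le> (2 ^ (k + 2))\<^sup>2" by (rule power_mono) simp
  then have "1 / 2 ^ (2 * (k + 2)) \<le> 1 / (real (block (Suc k) + 1))\<^sup>2"
    by (intro divide_left_mono) (auto simp flip: power_mult simp: mult.commute)
  also have "\<dots> \<le> cmod (z (block (Suc k)) 0)"
    using target_ge[of "block (Suc k)" 0] by (simp add: add.commute)
  finally have "cmod (\<beta> k) * (1 / 2 ^ (2 * (k + 2))) \<le> cmod (\<beta> k) * cmod (z (block (Suc k)) 0)"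
    by (rule mult_left_mono) simp
  then show ?thesis
    using assms by (simp add: cmod_\<beta>_Suc sq less_imp_neq[OF growth_pos, symmetric] del: \<beta>.simps)
qed

text \<open>A nonzero offset means n^2 \<le> k, so the growth ratio is at least that from k to k +
  1. The loss from target and factorial is at most the square of (n + 1) j! \<le> (k + 2)!.\<close>

lemma cmod_\<beta>_Suc_ge_nonsquare:
  assumes "offset (Suc k) \<noteq> 0"
  shows "cmod (\<beta> k) * 2 ^ (4 * k ^ 3) / 2 ^ (2 * (k + 2)\<^sup>2) \<le> cmod (\<beta> (Suc k))"
proof -
  define n j where "n = block (Suc k)" and "j = offset (Suc k)"
  have nj: "Suc k = n\<^sup>2 + j" unfolding n_def j_def by (rule block_offset)
  have "j \<noteq> 0" using assms by (simp add: j_def)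
  have "k ^ 4 + 4 * k ^ 3 \<le> Suc k ^ 4" by (simp add: eval_nat_numeral algebra_simps)
  moreover have "(n\<^sup>2) ^ 4 \<le> k ^ 4" by (rule power_mono) (use nj \<open>j \<noteq> 0\<close> in auto)
  ultimately have "(2 :: real) ^ (4 * k ^ 3 + (n\<^sup>2) ^ 4) \<le> 2 ^ Suc k ^ 4"
    by (intro power_increasing) auto
  then have 1: "2 ^ (4 * k ^ 3) \<le> growth (Suc k) / growth (n\<^sup>2)"
    by (simp add: growth_def pos_le_divide_eq power_add)
  have "(n + 1) * fact j \<le> (k + 2) * fact (k + 1)"
  proof (intro mult_mono fact_mono)
    show "n + 1 \<le> k + 2" by (simp add: n_def block_def floor_sqrt_le)
    show "j \<le> k + 1" using nj by simp
  qed auto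
  also have "\<dots> = fact (k + 2)" by (simp add: algebra_simps)
  finally have "real (n + 1) * fact j \<le> fact (k + 2)" by (metis of_nat_fact of_nat_le_iff of_nat_mult)
  also have "\<dots> \<le> 2 ^ (k + 2)\<^sup>2" by (rule fact_le_two_power_square)
  finally have "(real (n + 1) * fact j)\<^sup>2 \<le> (2 ^ (k + 2)\<^sup>2)\<^sup>2" by (rule power_mono) simp
  then have "1 / 2 ^ (2 * (k + 2)\<^sup>2) \<le> 1 / (real (n + 1) * fact j)\<^sup>2"
    by (intro divide_left_mono) (auto simp flip: power_mult simp: mult.commute)
  also have "\<dots> = 1 / (real (n + 1))\<^sup>2 / (fact j)\<^sup>2" by (simp add: power_mult_distrib)
  also have "\<dots> \<le> cmod (z n j) / (fact j)\<^sup>2" using target_ge[of n j] by (intro divide_right_mono) (auto simp: add.commute)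
  finally have "cmod (\<beta> k) * (2 ^ (4 * k ^ 3) * (1 / 2 ^ (2 * (k + 2)\<^sup>2)))
      \<le> cmod (\<beta> k) * (growth (Suc k) / growth (n\<^sup>2) * (cmod (z n j) / (fact j)\<^sup>2))"
    using 1 by (intro mult_left_mono mult_mono) (auto simp: less_imp_le)
  then show ?thesis unfolding cmod_\<beta>_Suc n_def j_def by simp
qed

text \<open>After n^2 with n \<ge> 1 the next square is 2n + 1 > 1 further on; k \<ge> 1 excludes
  the pair 0, 1.\<close>

lemma two_squares_not_consecutive:
  assumes "k \<ge> 1" "offset (Suc k) = 0"
  shows "offset k \<noteq> 0"
proof
  assume "offset k = 0"
  then have eq: "Suc ((block k)\<^sup>2) = (block (Suc k))\<^sup>2"
    using block_offset[of k] block_offset[of "Suc k"] assms(2) by simp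
  have "block k \<ge> 1" using assms(1) by (simp add: block_def Suc_le_eq)
  have "(block k)\<^sup>2 < (block (Suc k))\<^sup>2" using eq by simp
  then have "block k < block (Suc k)" by (rule power_less_imp_less_base) simp
  then have "(Suc (block k))\<^sup>2 \<le> (block (Suc k))\<^sup>2" by (intro power_mono) auto
  with eq \<open>block k \<ge> 1\<close> show False by (simp add: power2_eq_square)
qed

text \<open>
  At a square index \<open>\<beta>\<close> may shrink, so the induction carries a stronger bound at the other
  indices, from which the loss at a following square is paid.
\<close>

lemma \<beta>_growth: "\<exists>c>0. \<forall>i\<ge>11. c * 2 ^ (5 * i ^ 3) \<le> cmod (\<beta> i)"
proof -
  \<comment> \<open>Subtracting the loss 2(i + 2) of a square step leaves exactly 5(i + 1)^3, the
    weaker bound at i + 1.\<close>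
  define F where "F i = 5 * (i + 1) ^ 3 + 2 * (i + 2)" for i :: nat
  define c where "c = cmod (\<beta> 11) / 2 ^ F 11"
  have c: "c > 0" by (simp add: c_def \<beta>_nonzero del: \<beta>.simps)
  have mono: "c * 2 ^ (5 * i ^ 3) \<le> c * 2 ^ F i" for i
  proof -
    have "i ^ 3 \<le> (i + 1) ^ 3" by (rule power_mono) auto
    then have "5 * i ^ 3 \<le> F i" unfolding F_def by linarith
    then show ?thesis using c by (intro mult_left_mono power_increasing) auto
  qed
  have "c * 2 ^ (5 * i ^ 3) \<le> cmod (\<beta> i) \<and> (offset i \<noteq> 0 \<longrightarrow> c * 2 ^ F i \<le> cmod (\<beta> i))"
    if "i \<ge> 11" for i
    using that
  proof (induction i rule: dec_induct)
    case base
    have "c * 2 ^ F 11 = cmod (\<beta> 11)" by (simp add: c_def del: \<beta>.simps)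
    then show ?case using mono[of 11] by (metis order_refl)
  next
    case (step k)
    show ?case
    proof (cases "offset (Suc k) = 0")
      case True
      have "offset k \<noteq> 0" by (rule two_squares_not_consecutive) (use step True in auto)
      then have "c * 2 ^ F k / 2 ^ (2 * (k + 2)) \<le> cmod (\<beta> k) / 2 ^ (2 * (k + 2))"
        using step by (intro divide_right_mono) auto
      also have "\<dots> \<le> cmod (\<beta> (Suc k))" using True by (rule cmod_\<beta>_Suc_ge_square)
      finally show ?thesis using True by (simp add: F_def power_add del: \<beta>.simps)
    next
      case False
      \<comment> \<open>For k \<ge> 11 the surplus 4k^3 \<ge> 44k^2 exceeds 32k^2 + 70k +
        54.\<close>
      have "F (Suc k) + 2 * (k + 2)\<^sup>2 \<le> 5 * k ^ 3 + 4 * k ^ 3"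
      proof -
        have k2: "11 * k \<le> k * k" using step by (intro mult_right_mono) auto
        then have "11 * k * k \<le> k * k * k" by (rule mult_right_mono) simp
        moreover have "F (Suc k) + 2 * (k + 2)\<^sup>2 = 5 * k ^ 3 + 32 * (k * k) + 70 * k + 54"
          by (simp add: F_def power2_eq_square power3_eq_cube algebra_simps)
        moreover have "k ^ 3 = k * k * k" by (simp add: power3_eq_cube)
        ultimately show ?thesis using k2 \<open>11 \<le> k\<close> by linarith
      qed
      then have "c * 2 ^ (F (Suc k) + 2 * (k + 2)\<^sup>2) \<le> c * (2 ^ (5 * k ^ 3) * 2 ^ (4 * k ^ 3))"
        unfolding power_add[of _ "5 * k ^ 3", symmetric]
        using c by (intro mult_left_mono power_increasing) auto
      then have "c * 2 ^ F (Suc k) \<le> c * 2 ^ (5 * k ^ 3) * 2 ^ (4 * k ^ 3) / 2 ^ (2 * (k + 2)\<^sup>2)"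
        by (simp add: power_add pos_le_divide_eq mult.assoc)
      also have "\<dots> \<le> cmod (\<beta> k) * 2 ^ (4 * k ^ 3) / 2 ^ (2 * (k + 2)\<^sup>2)"
        using step by (intro divide_right_mono mult_right_mono) auto
      also have "\<dots> \<le> cmod (\<beta> (Suc k))" using False by (rule cmod_\<beta>_Suc_ge_nonsquare)
      finally show ?thesis using mono[of "Suc k"] by linarith
    qed
  qed
  with c show ?thesis by blast
qed

text \<open>The ratio of growths has exponent 4i^3 plus lower terms, against at least 5i^3 from
  \<beta>; the surplus i^3 pays for the squared factorial and a geometric factor.\<close>

lemma summable_b: "summable (\<lambda>i. cmod (b i))"
proof -
  obtain c where c: "c > 0" "\<And>i. i \<ge> 11 \<Longrightarrow> c * 2 ^ (5 * i ^ 3) \<le> cmod (\<beta> i)"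
    using \<beta>_growth by blast
  show ?thesis
  proof (rule summable_comparison_test')
    show "summable (\<lambda>i. 1 / c * (1 / 2 :: real) ^ i)"
      by (intro summable_mult summable_geometric) simp
    show "norm (cmod (b i)) \<le> 1 / c * (1 / 2) ^ i" if i: "i \<ge> 11" for i
    proof -
      have "cmod (b i) = (fact i)\<^sup>2 * growth (Suc i) / (growth i * cmod (\<beta> i))"
        by (simp add: b_def norm_mult norm_divide norm_power less_imp_le)
      also have "\<dots> \<le> (2 ^ i\<^sup>2)\<^sup>2 * growth (Suc i) / (growth i * (c * 2 ^ (5 * i ^ 3)))"
        using c i by (intro frac_le mult_mono power_mono fact_le_two_power_square mult_pos_pos)
          (auto simp: less_imp_le)
      also have "\<dots> = 2 ^ (i\<^sup>2 * 2 + Suc i ^ 4) / (c * 2 ^ (i ^ 4 + 5 * i ^ 3))"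
        by (simp add: growth_def power_add power_mult)
      also have "\<dots> \<le> 1 / c * (1 / 2) ^ i"
      proof -
        have "i\<^sup>2 * 2 + Suc i ^ 4 + i \<le> i ^ 4 + 5 * i ^ 3"
        proof -
          have i2: "11 * i \<le> i * i" using i by (intro mult_right_mono) auto
          then have "11 * i * i \<le> i * i * i" by (rule mult_right_mono) simp
          with i2 i show ?thesis by (simp add: eval_nat_numeral algebra_simps)
        qed
        then have "(2 :: real) ^ (i\<^sup>2 * 2 + Suc i ^ 4 + i) \<le> 2 ^ (i ^ 4 + 5 * i ^ 3)"
          by (intro power_increasing) auto
        then have "(2 :: real) ^ (i\<^sup>2 * 2 + Suc i ^ 4) * 2 ^ i \<le> 2 ^ (i ^ 4 + 5 * i ^ 3)"
          by (simp only: power_add)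
        then show ?thesis using c by (simp add: field_simps)
      qed
      finally show ?thesis by simp
    qed
  qed
qed

section \<open>The orbit at the times of the blocks\<close>

lemma nth_Abs_a: "ell1_nth (Abs_ell1 a) = a"
  by (simp add: Abs_ell1_inverse summable_a)

lemma nth_Abs_b: "ell1_nth (Abs_ell1 b) = b"
  by (simp add: Abs_ell1_inverse summable_b)

lemma orbit_even:
  "orbit_seq M_\<omega> (Abs_ell1 a) (Abs_ell1 b) (2 * k) = growth k *\<^sub>C (B_\<omega> ^^ k) (Abs_ell1 a)"
proof -
  have "complex_of_real (growth (Suc k)) =
      growth k * \<beta> k * ell1_nth (Abs_ell1 b) k / (fact k)\<^sup>2" for k
    by (simp add: nth_Abs_b b_def \<beta>_nonzero less_imp_neq[OF growth_pos, symmetric])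
  then show ?thesis
    by (intro conjunct1[OF orbit_M_\<omega>[of "\<lambda>k. complex_of_real (growth k)" \<beta>]])
      (simp_all add: growth_def nth_Abs_a)
qed

text \<open>The first 2n + 1 coordinates read off block n and equal the targets; the others come
  from later blocks and are bounded by a geometric series with sum (1/2)^n.\<close>

lemma orbit_near_target:
  assumes "n \<ge> 3"
  shows "norm (orbit_seq M_\<omega> (Abs_ell1 a) (Abs_ell1 b) (2 * n\<^sup>2) - x)
    \<le> (\<Sum>j<2 * n + 1. cmod (z n j - ell1_nth x j))
      + ((\<Sum>j. cmod (ell1_nth x (j + (2 * n + 1)))) + (1 / 2) ^ n)"
proof -
  define N where "N = 2 * n + 1"
  define y where "y = orbit_seq M_\<omega> (Abs_ell1 a) (Abs_ell1 b) (2 * n\<^sup>2)"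
  have y: "ell1_nth y j = growth (n\<^sup>2) * ((fact j / fact (j + n\<^sup>2))\<^sup>2 * a (j + n\<^sup>2))" for j
    unfolding y_def orbit_even by (simp add: scaleC_ell1.rep_eq nth_funpow_B_\<omega> nth_Abs_a)
  have head: "ell1_nth y j = z n j" if "j < N" for j
  proof -
    have "block (j + n\<^sup>2) = n" "offset (j + n\<^sup>2) = j"
      using block_offset_eq[of j n] that by (simp_all add: N_def add.commute)
    then show ?thesis
      by (simp add: y a_def power_divide less_imp_neq[OF growth_pos, symmetric])
  qed
  have geo: "(\<lambda>j. (1 / 2 :: real) ^ (n + 1) * (1 / 2) ^ j) sums ((1 / 2) ^ (n + 1) * 2)"
    using geometric_sums[of "1 / 2 :: real"] by (intro sums_mult) simp
  have tail: "cmod (ell1_nth (y - x) (j + N))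
      \<le> cmod (ell1_nth x (j + N)) + (1 / 2) ^ (n + 1) * (1 / 2) ^ j" for j
  proof -
    let ?i = "j + N + n\<^sup>2"
    \<comment> \<open>Coordinate N after n^2 shifts reads index (n + 1)^2, where the next block
      starts.\<close>
    have i: "?i = (n + 1)\<^sup>2 + j" by (simp add: N_def power2_eq_square)
    have "(fact (j + N) / fact ?i)\<^sup>2 \<le> (1 :: real)"
      by (intro power_le_one) (auto simp: divide_le_eq fact_mono)
    then have "growth (n\<^sup>2) * ((fact (j + N) / fact ?i)\<^sup>2 * cmod (a ?i))
        \<le> growth (n\<^sup>2) * (1 * cmod (a ?i))"
      by (intro mult_left_mono mult_right_mono) (auto simp: less_imp_le)
    then have "cmod (ell1_nth y (j + N)) \<le> growth (n\<^sup>2) * cmod (a ?i)"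
      by (simp add: y norm_mult norm_divide norm_power less_imp_le)
    also have "\<dots> \<le> (1 / 2) ^ ?i" using assms by (rule cmod_a_le) (simp add: i)
    also have "\<dots> \<le> (1 / 2) ^ (n + 1 + j)"
      unfolding i by (intro power_decreasing) (auto simp: power2_eq_square)
    finally show ?thesis
      using norm_triangle_ineq4[of "ell1_nth y (j + N)" "ell1_nth x (j + N)"]
      by (simp add: minus_ell1.rep_eq power_add)
  qed
  have sx: "summable (\<lambda>j. cmod (ell1_nth w (j + N)))" for w
    using summable_ell1_nth[of w] by (subst summable_iff_shift)
  have "norm (y - x) = (\<Sum>j<N. cmod (z n j - ell1_nth x j)) + (\<Sum>j. cmod (ell1_nth (y - x) (j + N)))"
    by (subst norm_ell1_split[of _ N]) (simp add: minus_ell1.rep_eq head)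
  also have "(\<Sum>j. cmod (ell1_nth (y - x) (j + N)))
      \<le> (\<Sum>j. cmod (ell1_nth x (j + N)) + (1 / 2) ^ (n + 1) * (1 / 2) ^ j)"
    by (intro suminf_le tail sx summable_add sums_summable[OF geo])
  also have "\<dots> = (\<Sum>j. cmod (ell1_nth x (j + N))) + (1 / 2) ^ n"
    using suminf_add[OF sx sums_summable[OF geo], of x] sums_unique[OF geo] by simp
  finally show ?thesis by (simp add: y_def N_def)
qed

end

section \<open>Hypercyclicity\<close>

lemma hypercyclic_M_\<omega>: "hypercyclic M_\<omega>"
proof -
  obtain d :: "nat \<Rightarrow> ell1" where d: "\<And>x e m. e > 0 \<Longrightarrow> \<exists>n\<ge>m. norm (d n - x) < e"
    using ex_recurrent_dense_seq_ell1 by blast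
  \<comment> \<open>The square makes replacing 2n + 1 entries cost only O(1/n) in total.\<close>
  define \<delta> where "\<delta> n = 1 / (real n + 1)\<^sup>2" for n
  have \<delta>: "0 \<le> \<delta> n" "\<delta> n \<le> 1" for n by (simp_all add: \<delta>_def divide_le_eq)
  define z where "z n j = (let w = ell1_nth (d n) j in
    if \<delta> n \<le> cmod w \<and> cmod w \<le> n + 1 then w else of_real (\<delta> n))" for n j :: nat
  interpret targets z
  proof
    fix n j :: nat
    have "\<delta> n \<le> cmod (z n j)"
      using \<delta>[of n] by (auto simp: z_def Let_def)
    then show "1 / (real n + 1)\<^sup>2 \<le> cmod (z n j)" by (simp add: \<delta>_def)
    show "cmod (z n j) \<le> real n + 1"
      using \<delta>[of n] by (auto simp: z_def Let_def)
  qed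
  let ?o = "orbit_seq M_\<omega> (Abs_ell1 a) (Abs_ell1 b)"
  have "\<exists>k. dist (?o k) x < e" if e: "e > 0" for x e
  proof -
    have "(\<lambda>n. 4 / (real n + 1)) \<longlonglongrightarrow> 0" by real_asymp
    moreover have "(\<lambda>n. (1 / 2 :: real) ^ n) \<longlonglongrightarrow> 0" by (rule LIMSEQ_power_zero) simp
    moreover have "(\<lambda>n. \<Sum>j. cmod (ell1_nth x (j + (2 * n + 1)))) \<longlonglongrightarrow> 0"
      by (rule filterlim_compose[OF ell1_tail_tendsto_0[of x]]) real_asymp
    ultimately have "(\<lambda>n. 4 / (real n + 1) + ((\<Sum>j. cmod (ell1_nth x (j + (2 * n + 1)))) + (1 / 2) ^ n))
        \<longlonglongrightarrow> 0 + (0 + 0)" by (intro tendsto_add)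
    then have "\<forall>\<^sub>F n in sequentially.
        4 / (real n + 1) + ((\<Sum>j. cmod (ell1_nth x (j + (2 * n + 1)))) + (1 / 2) ^ n) < e / 2"
      by (rule order_tendstoD) (use e in simp)
    moreover have "\<forall>\<^sub>F n in sequentially. norm x + e / 2 \<le> real n"
      using filterlim_real_sequentially by (simp add: filterlim_at_top)
    ultimately have "\<forall>\<^sub>F n in sequentially.
        4 / (real n + 1) + ((\<Sum>j. cmod (ell1_nth x (j + (2 * n + 1)))) + (1 / 2) ^ n) < e / 2
        \<and> norm x + e / 2 \<le> real n"
      by (rule eventually_conj)
    then obtain m where m: "\<And>n. n \<ge> m \<Longrightarrow>
        4 / (real n + 1) + ((\<Sum>j. cmod (ell1_nth x (j + (2 * n + 1)))) + (1 / 2) ^ n) < e / 2"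
        "\<And>n. n \<ge> m \<Longrightarrow> norm x + e / 2 \<le> real n"
      unfolding eventually_sequentially by blast
    obtain n where n: "n \<ge> max m 3" "norm (d n - x) < e / 2"
      using d[of "e / 2" "max m 3" x] e by (metis half_gt_zero)
    \<comment> \<open>This rules out entries that are too large, so only entries below
      \<open>\<delta> n\<close> get replaced, each moving by at most
      \<open>2 * \<delta> n\<close>.\<close>
    have "norm (d n) \<le> n"
      using norm_triangle_sub[of "d n" x] m(2)[of n] n by simp
    then have "cmod (ell1_nth (d n) j) \<le> n + 1" for j
      using cmod_nth_le_norm_ell1[of "d n" j] by simp
    then have "cmod (z n j - ell1_nth (d n) j) \<le> 2 * \<delta> n" for j
      using norm_triangle_ineq4[of "of_real (\<delta> n)" "ell1_nth (d n) j"] \<delta>(1)[of n]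
      by (auto simp: z_def Let_def)
    then have "(\<Sum>j<2 * n + 1. cmod (z n j - ell1_nth (d n) j)) 
        \<le> real (card {..<2 * n + 1}) * (2 * \<delta> n)"
      by (rule sum_bounded_above)
    also have "\<dots> \<le> 4 / (real n + 1)" 
      by (simp add: \<delta>_def divide_simps power2_eq_square)
    finally have 1: "(\<Sum>j<2 * n + 1. cmod (z n j - ell1_nth (d n) j)) \<le> 4 / (real n + 1)" .
    have 2: "(\<Sum>j<2 * n + 1. cmod (ell1_nth (d n) j - ell1_nth x j)) \<le> norm (d n - x)"
      using sum_cmod_le_norm_ell1[of "d n - x" "2 * n + 1"] by (simp add: minus_ell1.rep_eq)
    have "(\<Sum>j<2 * n + 1. cmod (z n j - ell1_nth x j)) \<le>
        (\<Sum>j<2 * n + 1. cmod (z n j - ell1_nth (d n) j) + cmod (ell1_nth (d n) j - ell1_nth x j))"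
      by (intro sum_mono norm_diff_triangle_le[OF order_refl order_refl])
    also have "\<dots> \<le> 4 / (real n + 1) + norm (d n - x)" using 1 2 by (simp only: sum.distrib)
    finally have "norm (?o (2 * n\<^sup>2) - x) < e"
      using orbit_near_target[of n x] m(1)[of n] n by linarith
    then show ?thesis by (auto simp: dist_norm)
  qed
  then have "x \<in> closure (range ?o)" for x
    by (auto simp: closure_approachable)
  then show ?thesis unfolding hypercyclic_def by blast
qed

theorem theorem3p4:
  shows "bounded_cbilinear M_\<omega> \<and> hypercyclic M_\<omega>"
  using bounded_cbilinear_M_\<omega> hypercyclic_M_\<omega> by blast

end
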